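(* Let $f:\mathbb{R}^d\to\mathbb{R}$ be continuous with a unique global minimizer $x^*$ and $\underline f:=f(x^* )=\min f=0$, and assume there exist $f_\infty,R_0,\eta>0$ and $\nu\in(0,\infty)$ such that $(f(x)-\underline f)^\nu\ge\eta|x-x^*|$ for every $x\in B_{R_0}(x^* )$ and $f(x)\ge\underline f+f_\infty$ for every $x\notin B_{R_0}(x^* )$. Let $\alpha,\lambda,\delta>0$ be fixed, $T>0$ given, and let $\rho^\alpha$ be a smooth solution on $[0,T]$ of $$\partial_t\rho^\alpha_t(x) = \lambda\, \mathrm{div}\big(\rho^\alpha_t(x)(x-X^\alpha(\rho^\alpha_t))\big) +\frac{\delta^2}{2}\Delta \rho^\alpha_t(x).$$ Let $\boldsymbol\rho_\infty=\mathcal N\big(x^*,\tfrac{\delta^2}{2\lambda}I_d\big)$ and, for $r>0$, $f_r:=\sup_{x\in B_r(x^* )}f(x)$. Then, for every $r\in(0,R_0]$ and every $0<q<f_\infty-f_r$, $$|X^\alpha(\rho^\alpha_t)-x^*|\le\frac{(q+f_r)^\nu}{\eta}+\frac{\delta}{\lambda^{1/2}}\frac{e^{-\alpha q}}{\rho^\alpha_t(B_r(x^* ))}\left(\mathcal H(\rho^\alpha_t\mid\boldsymbol\rho_\infty)^{1/2}+\frac1{\sqrt2}\right).$$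
   Context: For a probability measure $\rho$ on $\mathbb{R}^d$ and $\alpha>0$, the consensus point is $X^\alpha(\rho)=\frac{\int x e^{-\alpha f(x)}d\rho(x)}{\int e^{-\alpha f(x)}d\rho(x)}$. Relative entropy of probability densities: $\mathcal H(\rho\mid\pi)=\int\log(\rho/\pi)\rho\,dx$. Here $\rho_t^\alpha$ is a probability density for each $t$. *)

theory Defs
  imports "HOL-Probability.Probability"
begin

section \<open>Smooth functions and differential operators\<close>

text \<open>
  \<open>D b\<close> is the partial derivative in the coordinate direction \<open>b\<close>. The derivatives are taken within
  \<open>S\<close>, so that on a time-space cylinder \<open>{0..T} \<times> UNIV\<close> they are one-sided in time at the two end
  points and the derivatives are continuous up to them. On such a set they are unique.
\<close>

primrec Ck_on :: "nat \<Rightarrow> 'b::euclidean_space set \<Rightarrow> ('b \<Rightarrow> real) \<Rightarrow> bool" where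
  "Ck_on 0 S g \<longleftrightarrow> continuous_on S g"
| "Ck_on (Suc k) S g \<longleftrightarrow>
     (\<exists>D. (\<forall>x\<in>S. (g has_derivative (\<lambda>h. \<Sum>b\<in>Basis. (h \<bullet> b) * D b x)) (at x within S)) \<and>
          (\<forall>b\<in>Basis. Ck_on k S (D b)))"

definition smooth_on :: "'b::euclidean_space set \<Rightarrow> ('b \<Rightarrow> real) \<Rightarrow> bool" where
  "smooth_on S g \<longleftrightarrow> (\<forall>k. Ck_on k S g)"

definition divergence :: "('a::euclidean_space \<Rightarrow> 'a) \<Rightarrow> 'a \<Rightarrow> real" where
  "divergence V x = (\<Sum>b\<in>Basis. frechet_derivative V (at x) b \<bullet> b)"

definition gradient :: "('a::euclidean_space \<Rightarrow> real) \<Rightarrow> 'a \<Rightarrow> 'a" where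
  "gradient g x = (\<Sum>b\<in>Basis. frechet_derivative g (at x) b *\<^sub>R b)"

definition laplacian :: "('a::euclidean_space \<Rightarrow> real) \<Rightarrow> 'a \<Rightarrow> real" where
  "laplacian g x = divergence (gradient g) x"

section \<open>Densities, relative entropy and the consensus point\<close>

definition law :: "('a::euclidean_space \<Rightarrow> real) \<Rightarrow> 'a measure" where
  "law p = density lborel (\<lambda>x. ennreal (p x))"

definition prob_density :: "('a::euclidean_space \<Rightarrow> real) \<Rightarrow> bool" where
  "prob_density p \<longleftrightarrow> p \<in> borel_measurable borel \<and> (\<forall>x. 0 \<le> p x) \<and> prob_space (law p)"

text \<open>The isotropic Gaussian with mean \<open>m\<close> and covariance \<open>v\<close> times the identity.\<close>

definition gaussian_density :: "'a::euclidean_space \<Rightarrow> real \<Rightarrow> 'a \<Rightarrow> real" where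
  "gaussian_density m v x = exp (- (norm (x - m))\<^sup>2 / (2 * v)) / sqrt ((2 * pi * v) ^ DIM('a))"

text \<open>
  The relative entropy may be infinite, so it is the difference of the integrals of the positive and
  negative parts of the integrand. For probability densities \<open>p\<close> and \<open>w > 0\<close> the negative part always
  has a finite integral, because \<open>u * ln u \<ge> - 1 / e\<close>. Where \<open>p x = 0\<close> the integrand is \<open>0\<close>.
  (\<open>KL_divergence\<close> is real-valued and returns \<open>0\<close> when the integral diverges.)
\<close>

definition relative_entropy :: "('a::euclidean_space \<Rightarrow> real) \<Rightarrow> ('a \<Rightarrow> real) \<Rightarrow> ereal" where
  "relative_entropy p w =
     enn2ereal (\<integral>\<^sup>+x. ennreal (ln (p x / w x) * p x) \<partial>lborel) -
     enn2ereal (\<integral>\<^sup>+x. ennreal (- (ln (p x / w x) * p x)) \<partial>lborel)"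

definition ereal_sqrt :: "ereal \<Rightarrow> ereal" where
  "ereal_sqrt x = (if \<bar>x\<bar> = \<infinity> then x else ereal (sqrt (real_of_ereal x)))"

definition consensus_point :: "real \<Rightarrow> ('a::euclidean_space \<Rightarrow> real) \<Rightarrow> 'a measure \<Rightarrow> 'a" where
  "consensus_point \<alpha> f \<mu> =
     (\<integral>x. exp (- \<alpha> * f x) *\<^sub>R x \<partial>\<mu>) /\<^sub>R (\<integral>x. exp (- \<alpha> * f x) \<partial>\<mu>)"

section \<open>The consensus-based optimisation equation\<close>

text \<open>
  The integrability condition says that the numerator of the consensus point exists (the denominator
  is finite and positive when \<open>f\<close> is continuous and bounded below); without it the drift is undefined.
\<close>

definition smooth_cbo_solution ::
  "('a::euclidean_space \<Rightarrow> real) \<Rightarrow> real \<Rightarrow> real \<Rightarrow> real \<Rightarrow> real \<Rightarrow> (real \<Rightarrow> 'a \<Rightarrow> real) \<Rightarrow> bool" where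
  "smooth_cbo_solution f \<alpha> lam \<delta> T \<rho> \<longleftrightarrow>
     smooth_on ({0..T} \<times> UNIV) (\<lambda>(t, x). \<rho> t x) \<and>
     (\<forall>t\<in>{0..T}.
        prob_density (\<rho> t) \<and>
        integrable (law (\<rho> t)) (\<lambda>x. exp (- \<alpha> * f x) *\<^sub>R x) \<and>
        (\<forall>x. ((\<lambda>s. \<rho> s x) has_real_derivative
                lam * divergence (\<lambda>y. \<rho> t y *\<^sub>R (y - consensus_point \<alpha> f (law (\<rho> t)))) x
                + \<delta>\<^sup>2 / 2 * laplacian (\<rho> t) x) (at t within {0..T})))"

end

theory Submission
  imports Defs
begin

text \<open>
  Let \<open>u\<close> be the unit vector pointing from the minimiser \<open>xstar\<close> to the consensus point, and \<open>F\<close> the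
  supremum of \<open>f\<close> over the small ball. Where \<open>f \<le> q + F\<close>, the growth condition bounds
  \<open>u \<bullet> (x - xstar)\<close> by \<open>(q + F) powr \<nu> / \<eta>\<close>; elsewhere the weight is at most \<open>exp (- \<alpha> * (q + F))\<close>,
  while the normalising integral is at least \<open>exp (- \<alpha> * F)\<close> times the mass of the small ball.
  Only the moment of \<open>\<bar>u \<bullet> (x - xstar)\<bar>\<close> in the single direction \<open>u\<close> remains, so no dimensional
  constant appears. With \<open>\<sigma>\<^sup>2 = \<delta>\<^sup>2 / (2 * lam)\<close> it is at most \<open>\<sigma> * (1 + sqrt (2 * H))\<close>, by
  the Gibbs variational inequality and the Gaussian bound \<open>exp (s + s\<^sup>2 / 2)\<close> on the expectation of
  \<open>exp (s * \<bar>u \<bullet> (x - xstar)\<bar> / \<sigma>)\<close>.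
\<close>

section \<open>Gaussian densities and their exponential moments\<close>

lemma gaussian_density_pos:
  assumes "v > 0" shows "gaussian_density m v x > 0"
  using assms by (simp add: gaussian_density_def)

lemma borel_measurable_gaussian_density [measurable]:
  "gaussian_density m v \<in> borel_measurable borel"
  unfolding gaussian_density_def[abs_def] by measurable

text \<open>The squared norm splits over coordinates, so the density is a product of one-dimensional
  normal densities and Tonelli reduces the normalisation to dimension one.\<close>

lemma nn_integral_gaussian_density:
  fixes m :: "'a::euclidean_space"
  assumes "v > 0"
  shows "(\<integral>\<^sup>+x. ennreal (gaussian_density m v x) \<partial>lborel) = 1"
proof -
  have norm_sq: "(norm (x - m))\<^sup>2 = (\<Sum>b\<in>Basis. (x \<bullet> b - m \<bullet> b)\<^sup>2)" for x
    unfolding power2_norm_eq_inner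
    by (subst euclidean_inner) (simp add: power2_eq_square inner_diff_left)
  have split: "ennreal (gaussian_density m v x) =
      (\<Prod>b\<in>Basis. ennreal (normal_density (m \<bullet> b) (sqrt v) (x \<bullet> b)))" for x
  proof -
    have "gaussian_density m v x = (\<Prod>b\<in>(Basis::'a set). normal_density (m \<bullet> b) (sqrt v) (x \<bullet> b))"
      using assms
      by (simp add: gaussian_density_def normal_density_def norm_sq prod_dividef prod.distrib
          exp_sum[symmetric] sum_negf[symmetric] sum_divide_distrib real_sqrt_power)
    then show ?thesis
      by (simp add: prod_ennreal)
  qed
  have one: "(\<integral>\<^sup>+y. ennreal (normal_density a (sqrt v) y) \<partial>lborel) = 1" for a
    using assms prob_space.emeasure_space_1[OF prob_space_normal_density[of "sqrt v" a]]
    by (simp add: emeasure_density)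
  show ?thesis
    unfolding split by (subst nn_integral_lborel_prod) (auto simp: one)
qed

lemma has_bochner_integral_gaussian_density:
  assumes "v > 0"
  shows "has_bochner_integral lborel (gaussian_density m v) 1"
  by (rule has_bochner_integral_nn_integral)
    (use assms nn_integral_gaussian_density in \<open>auto intro: less_imp_le gaussian_density_pos\<close>)

text \<open>Completing the square: an exponential tilt only moves the mean of a Gaussian, so the
  moment generating function follows from the normalisation.\<close>

lemma gaussian_density_tilt:
  assumes "v > 0"
  shows "gaussian_density m v x * exp (h \<bullet> (x - m)) =
    exp (v * (norm h)\<^sup>2 / 2) * gaussian_density (m + v *\<^sub>R h) v x"
proof -
  have "(norm (x - (m + v *\<^sub>R h)))\<^sup>2 = (norm (x - m))\<^sup>2 - 2 * v * (h \<bullet> (x - m)) + v\<^sup>2 * (norm h)\<^sup>2"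
    unfolding power2_norm_eq_inner
    by (simp add: algebra_simps inner_commute power2_eq_square)
  then have "- (norm (x - m))\<^sup>2 / (2 * v) + h \<bullet> (x - m) =
      v * (norm h)\<^sup>2 / 2 + - (norm (x - (m + v *\<^sub>R h)))\<^sup>2 / (2 * v)"
    using assms by (simp add: field_simps power2_eq_square)
  then show ?thesis
    by (simp add: gaussian_density_def exp_add[symmetric])
qed

lemma has_bochner_integral_gaussian_exp:
  fixes m :: "'a::euclidean_space"
  assumes "v > 0"
  shows "has_bochner_integral lborel (\<lambda>x. gaussian_density m v x * exp (h \<bullet> (x - m)))
    (exp (v * (norm h)\<^sup>2 / 2))"
  unfolding gaussian_density_tilt[OF assms]
  using has_bochner_integral_mult_right
    [OF has_bochner_integral_gaussian_density[OF assms, of "m + v *\<^sub>R h"]]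
  by fastforce

text \<open>
  Writing \<open>exp \<bar>z\<bar> = cosh z + \<bar>sinh z\<bar>\<close> and applying AM-GM to \<open>\<bar>sinh z\<bar>\<close> leaves only
  exponentials of linear functions, whose Gaussian integrals are explicit.
\<close>

lemma exp_abs_le_am_gm:
  fixes c z :: real
  assumes "c > 0"
  shows "exp \<bar>z\<bar> \<le> (exp z + exp (- z)) / 2 + c / 2 + ((exp (2 * z) + exp (- 2 * z)) / 2 - 1) / (4 * c)"
proof -
  define S where "S = (exp z - exp (- z)) / 2"
  have "exp \<bar>z\<bar> \<le> (exp z + exp (- z)) / 2 + \<bar>S\<bar>"
    by (cases "z \<ge> 0") (auto simp: S_def abs_if field_simps)
  moreover have "\<bar>S\<bar> \<le> c / 2 + S\<^sup>2 / (2 * c)"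
  proof -
    have "0 \<le> (\<bar>S\<bar> - c)\<^sup>2 / (2 * c)"
      using assms by simp
    also have "\<dots> = c / 2 + S\<^sup>2 / (2 * c) - \<bar>S\<bar>"
      using assms by (simp add: field_simps power2_eq_square abs_mult_self_eq)
    finally show ?thesis by simp
  qed
  moreover have "S\<^sup>2 = ((exp (2 * z) + exp (- 2 * z)) / 2 - 1) / 2"
  proof -
    have "exp (2 * z) = (exp z)\<^sup>2" "exp (- 2 * z) = (exp (- z))\<^sup>2" "exp z * exp (- z) = 1"
      using exp_double[of z] exp_double[of "- z"] by (simp_all add: exp_minus_inverse)
    then show ?thesis
      by (simp add: S_def power_divide power2_diff)
  qed
  ultimately show ?thesis
    by (simp add: field_simps)
qed

text \<open>What remains of the target \<open>exp (s + s\<^sup>2 / 2)\<close> in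
  \<open>gaussian_exp_abs\<close> once \<open>exp (s\<^sup>2 / 2)\<close> is cancelled. For
  \<open>s \<le> 1\<close> the left side stays below \<open>1 + s + s\<^sup>2 / 2\<close>, a Taylor
  minorant of \<open>exp s\<close>.\<close>

lemma exp_diff_le:
  fixes s :: real
  assumes "0 < s" "s \<le> 1"
  shows "1 + s / 2 + (exp (s\<^sup>2) - exp (- s\<^sup>2)) / (4 * s) \<le> exp s"
proof -
  have s2: "s\<^sup>2 \<le> 1" "0 \<le> s\<^sup>2"
    using assms by (simp_all add: power_le_one)
  have "exp (s\<^sup>2) \<le> 1 + s\<^sup>2 + (s\<^sup>2)\<^sup>2"
    using exp_bound s2 by blast
  moreover have "1 - s\<^sup>2 \<le> exp (- s\<^sup>2)"
    using exp_ge_add_one_self[of "- s\<^sup>2"] by simp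
  ultimately have "exp (s\<^sup>2) - exp (- s\<^sup>2) \<le> 2 * s\<^sup>2 + (s\<^sup>2)\<^sup>2" by simp
  also have "(s\<^sup>2)\<^sup>2 = s ^ 3 * s"
    by (simp add: power2_eq_square power3_eq_cube)
  also have "\<dots> \<le> s ^ 3 * 1"
    using assms by (intro mult_left_mono) auto
  finally have "(exp (s\<^sup>2) - exp (- s\<^sup>2)) / (4 * s) \<le> (2 * s\<^sup>2 + s ^ 3) / (4 * s)"
    using assms by (intro divide_right_mono) auto
  also have "\<dots> = s / 2 + s\<^sup>2 / 4"
    using assms by (simp add: field_simps power2_eq_square power3_eq_cube)
  finally have "1 + s / 2 + (exp (s\<^sup>2) - exp (- s\<^sup>2)) / (4 * s) \<le> 1 + s + s\<^sup>2 / 2"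
    using s2(2) by linarith
  also have "\<dots> \<le> exp s"
    using exp_lower_Taylor_quadratic[of s] assms by simp
  finally show ?thesis .
qed

text \<open>Under the Gaussian, \<open>h \<bullet> (x - m)\<close> is centred normal with standard
  deviation \<open>s\<close>. For \<open>s > 1\<close> the crude bound by two exponentials is
  affordable because \<open>2 \<le> exp s\<close>; for small \<open>s\<close> the bound must tend to
  1, which the AM-GM estimate achieves.\<close>

lemma gaussian_exp_abs:
  fixes m :: "'a::euclidean_space"
  assumes v: "v > 0" and h: "h \<noteq> 0"
  defines "s \<equiv> sqrt v * norm h"
  shows "integrable lborel (\<lambda>x. gaussian_density m v x * exp \<bar>h \<bullet> (x - m)\<bar>)"
    and "(\<integral>x. gaussian_density m v x * exp \<bar>h \<bullet> (x - m)\<bar> \<partial>lborel) \<le> exp (s + s\<^sup>2 / 2)"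
proof -
  let ?w = "gaussian_density m v"
  have s: "s > 0" "s\<^sup>2 = v * (norm h)\<^sup>2"
    using v h by (auto simp: s_def power_mult_distrib)
  have mgf: "has_bochner_integral lborel (\<lambda>x. ?w x * exp (k * (h \<bullet> (x - m)))) (exp (k\<^sup>2 * s\<^sup>2 / 2))"
    for k
    using has_bochner_integral_gaussian_exp[OF v, of m "k *\<^sub>R h"] s
    by (simp add: power_mult_distrib mult_ac)
  note mgfs = mgf[of 1, simplified] mgf[of "-1", simplified] mgf[of 2, simplified] mgf[of "-2", simplified]
  have w0: "?w x \<ge> 0" for x
    using gaussian_density_pos[OF v] less_imp_le by blast
  note w1 = has_bochner_integral_gaussian_density[OF v, of m]
  have two: "has_bochner_integral lborel
      (\<lambda>x. ?w x * exp (h \<bullet> (x - m)) + ?w x * exp (- (h \<bullet> (x - m)))) (2 * exp (s\<^sup>2 / 2))"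
    using has_bochner_integral_add[OF mgfs(1,2)] by simp
  have le_two: "?w x * exp \<bar>z\<bar> \<le> ?w x * exp z + ?w x * exp (- z)" for x z
    using w0[of x] by (auto simp: abs_if distrib_left[symmetric] intro!: mult_left_mono)
  show int: "integrable lborel (\<lambda>x. ?w x * exp \<bar>h \<bullet> (x - m)\<bar>)"
    by (rule Bochner_Integration.integrable_bound[OF integrable.intros[OF two]])
      (use w0 le_two in \<open>auto simp: abs_mult intro!: AE_I2 order_trans[OF le_two abs_ge_self]\<close>)
  show "(\<integral>x. ?w x * exp \<bar>h \<bullet> (x - m)\<bar> \<partial>lborel) \<le> exp (s + s\<^sup>2 / 2)"
  proof (cases "s \<le> 1")
    case False
    have "(\<integral>x. ?w x * exp \<bar>h \<bullet> (x - m)\<bar> \<partial>lborel) \<le> 2 * exp (s\<^sup>2 / 2)"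
      unfolding has_bochner_integral_integral_eq[OF two, symmetric]
      by (rule integral_mono[OF int integrable.intros[OF two]]) (rule le_two)
    also have "\<dots> \<le> exp s * exp (s\<^sup>2 / 2)"
    proof (rule mult_right_mono)
      show "2 \<le> exp s"
        using exp_ge_add_one_self[of s] False by linarith
    qed simp
    finally show ?thesis
      by (simp add: exp_add)
  next
    case True
    \<comment> \<open>To leading order in \<open>s\<close> this is the root mean square of
      \<open>sinh (h \<bullet> (x - m))\<close>, the optimal AM-GM weight; it also lets
      \<open>exp (s\<^sup>2 / 2)\<close> factor out of all of \<open>?I\<close>.\<close>
    define c where "c = s * exp (s\<^sup>2 / 2)"
    have c: "c > 0" using s by (simp add: c_def)
    let ?g = "\<lambda>x. (?w x * exp (h \<bullet> (x - m)) + ?w x * exp (- (h \<bullet> (x - m)))) * (1 / 2) + ?w x * (c / 2)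
      + ((?w x * exp (2 * (h \<bullet> (x - m))) + ?w x * exp (- 2 * (h \<bullet> (x - m)))) * (1 / 2) - ?w x) * (1 / (4 * c))"
    let ?I = "(2 * exp (s\<^sup>2 / 2)) * (1 / 2) + 1 * (c / 2)
      + ((exp (2 * s\<^sup>2) + exp (2 * s\<^sup>2)) * (1 / 2) - 1) * (1 / (4 * c))"
    have g: "has_bochner_integral lborel ?g ?I"
      using mgfs by (intro has_bochner_integral_add has_bochner_integral_diff
          has_bochner_integral_mult_left two w1) auto
    have "?w x * exp \<bar>h \<bullet> (x - m)\<bar> \<le> ?g x" for x
      using mult_left_mono[OF exp_abs_le_am_gm[OF c, of "h \<bullet> (x - m)"] w0[of x]]
      by (simp add: algebra_simps add_divide_distrib diff_divide_distrib)
    then have "(\<integral>x. ?w x * exp \<bar>h \<bullet> (x - m)\<bar> \<partial>lborel) \<le> ?I"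
      unfolding has_bochner_integral_integral_eq[OF g, symmetric]
      by (intro integral_mono[OF int integrable.intros[OF g]])
    also have "?I = exp (s\<^sup>2 / 2) * (1 + s / 2 + (exp (s\<^sup>2) - exp (- s\<^sup>2)) / (4 * s))"
    proof -
      define e where "e = exp (s\<^sup>2 / 2)"
      have e: "e > 0" "exp (s\<^sup>2) = e\<^sup>2" "exp (2 * s\<^sup>2) = e ^ 4" "exp (- s\<^sup>2) = 1 / e\<^sup>2"
        by (auto simp: e_def exp_of_nat_mult[symmetric] exp_minus field_simps simp flip: exp_double)
      show ?thesis
        using s e unfolding c_def e_def[symmetric]
        by (simp add: field_simps eval_nat_numeral)
    qed
    also have "\<dots> \<le> exp (s\<^sup>2 / 2) * exp s"
      using exp_diff_le[OF s(1) True] by simp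
    finally show ?thesis
      by (simp add: exp_add mult.commute)
  qed
qed

section \<open>Relative entropy and the Gibbs variational inequality\<close>

text \<open>Fenchel-Young inequality: \<open>w * exp a\<close> is the convex conjugate of
  \<open>p * ln (p / w) - p\<close>, with equality at \<open>p = w * exp a\<close>. For
  \<open>p > 0\<close> it is \<open>ln y \<le> y - 1\<close> at
  \<open>y = w * exp a / p\<close>.\<close>

lemma entropy_young:
  fixes a p w :: real
  assumes "p \<ge> 0" "w > 0"
  shows "a * p \<le> ln (p / w) * p - p + w * exp a"
proof (cases "p = 0")
  case False
  with assms have p: "p > 0" by simp
  have "ln (w * exp a / p) \<le> w * exp a / p - 1"
    using p assms by (intro ln_le_minus_one) simp
  then have "(a - ln (p / w)) * p \<le> (w * exp a / p - 1) * p"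
    using p assms by (intro mult_right_mono) (auto simp: ln_mult ln_div)
  then show ?thesis using p by (simp add: algebra_simps)
qed (use assms in simp)

lemma prob_density_integral:
  assumes "prob_density p"
  shows "has_bochner_integral lborel p 1"
proof -
  have [measurable]: "p \<in> borel_measurable borel" and p0: "\<And>x. 0 \<le> p x"
    and "prob_space (law p)"
    using assms by (auto simp: prob_density_def)
  then have "(\<integral>\<^sup>+x. ennreal (p x) \<partial>lborel) = 1"
    using prob_space.emeasure_space_1[of "law p"] by (simp add: law_def emeasure_density)
  then show ?thesis
    using p0 by (intro has_bochner_integral_nn_integral) auto
qed

text \<open>Young's inequality with \<open>a = 0\<close> bounds the negative part by the integrable
  \<open>w\<close>, so only the positive part could diverge, and finite entropy excludes
  that.\<close>

lemma relative_entropy_eq_integral: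
  assumes p: "prob_density p" and [measurable]: "w \<in> borel_measurable borel"
    and w0: "\<And>x. w x > 0" and wint: "integrable lborel w"
    and fin: "relative_entropy p w \<noteq> \<infinity>"
  shows "integrable lborel (\<lambda>x. ln (p x / w x) * p x)"
    and "relative_entropy p w = ereal (\<integral>x. ln (p x / w x) * p x \<partial>lborel)"
proof -
  let ?L = "\<lambda>x. ln (p x / w x) * p x"
  have [measurable]: "p \<in> borel_measurable borel" and p0: "\<And>x. 0 \<le> p x"
    using p by (auto simp: prob_density_def)
  have "(\<integral>\<^sup>+x. ennreal (- ?L x) \<partial>lborel) \<le> (\<integral>\<^sup>+x. ennreal (w x) \<partial>lborel)"
  proof (intro nn_integral_mono ennreal_leI)
    show "- ?L x \<le> w x" for x
      using entropy_young[OF p0 w0, of 0 x x] p0[of x] by simp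
  qed
  also have "\<dots> < \<infinity>"
    using wint w0 by (simp add: nn_integral_eq_integral less_imp_le)
  finally have neg: "(\<integral>\<^sup>+x. ennreal (- ?L x) \<partial>lborel) < \<infinity>" .
  have pos: "(\<integral>\<^sup>+x. ennreal (?L x) \<partial>lborel) < \<infinity>"
    using fin by (cases "(\<integral>\<^sup>+x. ennreal (?L x) \<partial>lborel) = top") (auto simp: relative_entropy_def less_top)
  show int: "integrable lborel ?L"
    using neg pos by (auto simp: real_integrable_def)
  show "relative_entropy p w = ereal (\<integral>x. ?L x \<partial>lborel)"
    unfolding relative_entropy_def real_lebesgue_integral_def[OF int]
    using neg pos by (cases "\<integral>\<^sup>+x. ennreal (?L x) \<partial>lborel"; cases "\<integral>\<^sup>+x. ennreal (- ?L x) \<partial>lborel")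
      (auto simp: top_unique less_top)
qed

text \<open>The Gibbs variational inequality, by integrating \<open>entropy_young\<close>. The same
  pointwise bound gives integrability of \<open>g x * p x\<close>, because that product is
  nonnegative.\<close>

lemma entropy_inequality:
  assumes p: "prob_density p" and [measurable]: "w \<in> borel_measurable borel"
    and w0: "\<And>x. w x > 0" and wint: "integrable lborel w"
    and fin: "relative_entropy p w \<noteq> \<infinity>"
    and [measurable]: "g \<in> borel_measurable borel" and g0: "\<And>x. g x \<ge> 0"
    and ge: "integrable lborel (\<lambda>x. w x * exp (g x))"
    and gB: "(\<integral>x. w x * exp (g x) \<partial>lborel) \<le> exp B"
  shows "integrable lborel (\<lambda>x. g x * p x)"
    and "ereal (\<integral>x. g x * p x \<partial>lborel) \<le> relative_entropy p w + ereal B"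
proof -
  let ?L = "\<lambda>x. ln (p x / w x) * p x"
  have [measurable]: "p \<in> borel_measurable borel" and p0: "\<And>x. 0 \<le> p x"
    using p by (auto simp: prob_density_def)
  note L = relative_entropy_eq_integral[OF p _ w0 wint fin]
  note p1 = prob_density_integral[OF p]
  \<comment> \<open>Shifting the exponent by \<open>B\<close> caps the integral of the last term at
    1, which cancels the \<open>- 1\<close> coming from the mass of \<open>p\<close>.\<close>
  have bnd: "g x * p x \<le> ?L x + (B - 1) * p x + exp (- B) * (w x * exp (g x))" for x
    using entropy_young[OF p0 w0, of "g x - B" x] by (simp add: algebra_simps exp_diff exp_minus field_simps)
  have rint: "integrable lborel (\<lambda>x. ?L x + (B - 1) * p x + exp (- B) * (w x * exp (g x)))"
    using L(1) ge integrable.intros[OF p1] by auto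
  show gp: "integrable lborel (\<lambda>x. g x * p x)"
    by (rule Bochner_Integration.integrable_bound[OF rint])
      (use g0 p0 in \<open>auto intro!: AE_I2 order_trans[OF bnd abs_ge_self] simp: abs_mult\<close>)
  have "(\<integral>x. g x * p x \<partial>lborel)
      \<le> (\<integral>x. ?L x + (B - 1) * p x + exp (- B) * (w x * exp (g x)) \<partial>lborel)"
    by (rule integral_mono[OF gp rint bnd])
  also have "\<dots> = (\<integral>x. ?L x \<partial>lborel) + (B - 1) + exp (- B) * (\<integral>x. w x * exp (g x) \<partial>lborel)"
    using L(1) ge integrable.intros[OF p1] has_bochner_integral_integral_eq[OF p1] by simp
  also have "\<dots> \<le> (\<integral>x. ?L x \<partial>lborel) + (B - 1) + exp (- B) * exp B"
    using gB by simp
  also have "\<dots> = (\<integral>x. ?L x \<partial>lborel) + B"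
    by (simp add: exp_minus)
  finally show "ereal (\<integral>x. g x * p x \<partial>lborel) \<le> relative_entropy p w + ereal B"
    using L(2) by simp
qed

text \<open>The case \<open>g = 0\<close>, \<open>B = 0\<close> of the variational inequality, as
  \<open>w\<close> has mass 1.\<close>

lemma relative_entropy_nonneg:
  assumes p: "prob_density p" and w: "w \<in> borel_measurable borel"
    and w0: "\<And>x. w x > 0" and w1: "has_bochner_integral lborel w 1"
  shows "relative_entropy p w \<ge> 0"
proof (cases "relative_entropy p w = \<infinity>")
  case False
  show ?thesis
    using entropy_inequality(2)[OF p w w0 integrable.intros[OF w1] False, of "\<lambda>_. 0" 0]
      integrable.intros[OF w1] has_bochner_integral_integral_eq[OF w1]
    by (simp add: zero_ereal_def[symmetric])
qed simp

text \<open>Testing the entropy with \<open>s / sqrt v\<close> times the absolute projection bounds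
  the moment by \<open>sqrt v * (H / s + 1 + s / 2)\<close> for every \<open>s > 0\<close>; the
  minimiser is \<open>s = sqrt (2 * H)\<close>.\<close>

lemma first_moment_le_entropy:
  fixes u m :: "'a::euclidean_space"
  assumes p: "prob_density p" and v: "v > 0" and u: "norm u = 1"
    and H: "relative_entropy p (gaussian_density m v) = ereal H"
  shows "integrable lborel (\<lambda>x. \<bar>u \<bullet> (x - m)\<bar> * p x)"
    and "(\<integral>x. \<bar>u \<bullet> (x - m)\<bar> * p x \<partial>lborel) \<le> sqrt v * (1 + sqrt (2 * H))"
proof -
  note w1 = has_bochner_integral_gaussian_density[OF v, of m]
  have w0: "\<And>x. gaussian_density m v x > 0"
    using gaussian_density_pos[OF v] .
  have H0: "H \<ge> 0"
    using relative_entropy_nonneg[OF p borel_measurable_gaussian_density w0 w1] H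
    by simp
  define M where "M = (\<integral>x. \<bar>u \<bullet> (x - m)\<bar> * p x \<partial>lborel)"
  have fin: "relative_entropy p (gaussian_density m v) \<noteq> \<infinity>"
    by (simp add: H)
  have *: "integrable lborel (\<lambda>x. \<bar>u \<bullet> (x - m)\<bar> * p x) \<and> s * M \<le> sqrt v * (H + s + s\<^sup>2 / 2)"
    if s: "s > 0" for s
  proof -
    define h where "h = (s / sqrt v) *\<^sub>R u"
    have sh: "sqrt v * norm h = s" "h \<noteq> 0"
      using s v u by (auto simp: h_def)
    have abs_h: "\<bar>h \<bullet> (x - m)\<bar> = s / sqrt v * \<bar>u \<bullet> (x - m)\<bar>" for x
      using s v by (simp add: h_def abs_mult)
    note E = entropy_inequality[OF p borel_measurable_gaussian_density w0 integrable.intros[OF w1] fin,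
        of "\<lambda>x. \<bar>h \<bullet> (x - m)\<bar>", OF _ abs_ge_zero gaussian_exp_abs[OF v sh(2)], unfolded sh(1)]
    have "integrable lborel (\<lambda>x. s / sqrt v * (\<bar>u \<bullet> (x - m)\<bar> * p x))"
      using E(1) by (simp add: abs_h mult.assoc)
    from iffD1[OF integrable_mult_left_iff this]
    have int: "integrable lborel (\<lambda>x. \<bar>u \<bullet> (x - m)\<bar> * p x)"
      using s v by simp
    have "(\<integral>x. s / sqrt v * (\<bar>u \<bullet> (x - m)\<bar> * p x) \<partial>lborel) \<le> H + (s + s\<^sup>2 / 2)"
      using E(2) by (simp add: abs_h mult.assoc H)
    then have "s / sqrt v * M \<le> H + (s + s\<^sup>2 / 2)"
      using int by (simp add: M_def)
    then show ?thesis
      using int v by (simp add: field_simps)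
  qed
  show "integrable lborel (\<lambda>x. \<bar>u \<bullet> (x - m)\<bar> * p x)"
    using *[of 1] by simp
  show "(\<integral>x. \<bar>u \<bullet> (x - m)\<bar> * p x \<partial>lborel) \<le> sqrt v * (1 + sqrt (2 * H))"
  \<comment> \<open>For \<open>H = 0\<close> the optimal \<open>s\<close> would be 0, which is not
    admissible, so the bound is approached with small positive \<open>s\<close>.\<close>
  proof (cases "H = 0")
    case True
    have "M \<le> sqrt v + e" if e: "e > 0" for e
    proof -
      \<comment> \<open>Solves \<open>sqrt v * s / 2 = e\<close>.\<close>
      define s where "s = 2 * e / sqrt v"
      have s: "s > 0" using e v by (simp add: s_def)
      have "s * M \<le> s * (sqrt v * (1 + s / 2))"
        using *[OF s] True by (simp add: algebra_simps power2_eq_square)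
      then have "M \<le> sqrt v * (1 + s / 2)"
        using s by simp
      also have "\<dots> = sqrt v + e"
        using v by (simp add: s_def field_simps)
      finally show ?thesis .
    qed
    then have "M \<le> sqrt v"
      by (rule field_le_epsilon)
    then show ?thesis
      using True by (simp add: M_def)
  next
    case False
    define s where "s = sqrt (2 * H)"
    have s: "s > 0" "H = s\<^sup>2 / 2"
      using H0 False by (auto simp: s_def)
    have "s * M \<le> s * (sqrt v * (1 + s))"
      using *[OF s(1)] s(2) by (simp add: algebra_simps power2_eq_square)
    then show ?thesis
      using s(1) unfolding M_def s_def by simp
  qed
qed

section \<open>Quantitative Laplace principle for the consensus point\<close>

text \<open>The two levels are kept abstract: above \<open>c\<close> the weight counts as small,
  \<open>a\<close> bounds \<open>f\<close> on the ball that controls the normalisation, and the gap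
  \<open>c - a\<close> sets the exponential factor.\<close>

lemma consensus_point_dist:
  fixes f :: "'a::euclidean_space \<Rightarrow> real" and m :: 'a
  assumes p: "prob_density p" and [measurable]: "f \<in> borel_measurable borel"
    and f0: "\<And>x. 0 \<le> f x" and \<alpha>: "\<alpha> \<ge> 0"
    and num: "integrable (law p) (\<lambda>x. exp (- \<alpha> * f x) *\<^sub>R x)"
    and level: "\<And>x. f x \<le> c \<Longrightarrow> norm (x - m) \<le> K" and K0: "K \<ge> 0"
    and ball: "\<And>x. x \<in> ball m r \<Longrightarrow> f x \<le> a"
    and mass: "measure (law p) (ball m r) > 0"
    and mom: "\<And>u. norm u = 1 \<Longrightarrow> integrable (law p) (\<lambda>x. \<bar>u \<bullet> (x - m)\<bar>)"
    and momM: "\<And>u. norm u = 1 \<Longrightarrow> (\<integral>x. \<bar>u \<bullet> (x - m)\<bar> \<partial>law p) \<le> M"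
  shows "norm (consensus_point \<alpha> f (law p) - m) \<le>
    K + exp (- \<alpha> * (c - a)) / measure (law p) (ball m r) * M"
proof -
  interpret prob_space "law p" using p by (simp add: prob_density_def)
  have [measurable_cong]: "sets (law p) = sets borel" and [simp]: "space (law p) = UNIV"
    by (auto simp: law_def)
  define E where "E = (\<lambda>x. exp (- \<alpha> * f x))"
  have E: "0 < E x" "E x \<le> 1" for x
    using f0[of x] \<alpha> by (auto simp: E_def)
  have [measurable]: "E \<in> borel_measurable borel"
    unfolding E_def by measurable
  have Eint: "integrable (law p) E"
    by (rule integrable_const_bound[of _ 1]) (use E in \<open>auto simp: less_imp_le\<close>)
  define Z where "Z = (\<integral>x. E x \<partial>law p)"
  define P where "P = measure (law p) (ball m r)"
  define X where "X = consensus_point \<alpha> f (law p)"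
  have ZP: "Z \<ge> exp (- \<alpha> * a) * P"
  proof -
    have "exp (- \<alpha> * a) * P = (\<integral>x. exp (- \<alpha> * a) * indicator (ball m r) x \<partial>law p)"
      by (simp add: P_def)
    also have "\<dots> \<le> Z"
      unfolding Z_def
    proof (rule integral_mono[OF _ Eint])
      show "integrable (law p) (\<lambda>x. exp (- \<alpha> * a) * indicator (ball m r) x)"
        by (intro integrable_mult_right integrable_real_indicator) (auto simp: emeasure_eq_measure)
      show "exp (- \<alpha> * a) * indicator (ball m r) x \<le> E x" for x
        using ball[of x] \<alpha> E(1)[of x] by (auto simp: E_def indicator_def mult_left_mono)
    qed
    finally show ?thesis .
  qed
  have P: "P > 0" using mass by (simp add: P_def)
  then have Z: "Z > 0" using ZP by (smt (verit) exp_gt_zero mult_pos_pos)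
  \<comment> \<open>\<open>u\<close> realises the norm as an inner product; when
    \<open>X = m\<close> any unit vector does, so a basis vector is taken.\<close>
  obtain u where u: "norm u = 1" "u \<bullet> (X - m) = norm (X - m)"
  proof (cases "X = m")
    case True
    then show ?thesis using that[of "SOME b. b \<in> Basis"] by (simp add: SOME_Basis)
  next
    case False
    then show ?thesis using that[of "sgn (X - m)"]
      by (simp add: norm_sgn sgn_div_norm power2_norm_eq_inner[symmetric] power2_eq_square)
  qed
  have num': "integrable (law p) (\<lambda>x. E x *\<^sub>R x)"
    using num by (simp add: E_def)
  have uint: "integrable (law p) (\<lambda>x. E x * (u \<bullet> x))"
    using integrable_inner_right[of u, OF num'] by simp
  have ZX: "Z *\<^sub>R X = (\<integral>x. E x *\<^sub>R x \<partial>law p)"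
    using Z by (simp add: X_def consensus_point_def Z_def E_def)
  \<comment> \<open>Multiplying by \<open>Z\<close> clears the quotient in the consensus point and
    leaves a scalar integral that can be estimated pointwise.\<close>
  have "Z * norm (X - m) = u \<bullet> (Z *\<^sub>R X) - (u \<bullet> m) * Z"
    unfolding u(2)[symmetric] by (simp add: algebra_simps)
  also have "u \<bullet> (Z *\<^sub>R X) = (\<integral>x. E x * (u \<bullet> x) \<partial>law p)"
    unfolding ZX using integral_inner_right[of u, OF num'] by simp
  also have "\<dots> - (u \<bullet> m) * Z = (\<integral>x. E x * (u \<bullet> x) - (u \<bullet> m) * E x \<partial>law p)"
    using uint Eint by (simp add: Z_def)
  also have "\<dots> \<le> (\<integral>x. K * E x + exp (- \<alpha> * c) * \<bar>u \<bullet> (x - m)\<bar> \<partial>law p)"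
  proof (rule integral_mono)
    show "integrable (law p) (\<lambda>x. E x * (u \<bullet> x) - (u \<bullet> m) * E x)"
      using uint Eint by auto
    show "integrable (law p) (\<lambda>x. K * E x + exp (- \<alpha> * c) * \<bar>u \<bullet> (x - m)\<bar>)"
      using mom[OF u(1)] Eint by auto
    show "E x * (u \<bullet> x) - (u \<bullet> m) * E x \<le> K * E x + exp (- \<alpha> * c) * \<bar>u \<bullet> (x - m)\<bar>" for x
    proof -
      have eq: "E x * (u \<bullet> x) - (u \<bullet> m) * E x = E x * (u \<bullet> (x - m))"
        by (simp add: algebra_simps)
      show ?thesis
      proof (cases "f x \<le> c")
        case True
        have "u \<bullet> (x - m) \<le> K"
          using level[OF True] norm_cauchy_schwarz[of u "x - m"] u(1) by simp
        then have "E x * (u \<bullet> (x - m)) \<le> E x * K"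
          using E(1)[of x] by (intro mult_left_mono) auto
        also have "\<dots> \<le> K * E x + exp (- \<alpha> * c) * \<bar>u \<bullet> (x - m)\<bar>"
          by (simp add: mult.commute)
        finally show ?thesis unfolding eq .
      next
        case False
        then have "E x \<le> exp (- \<alpha> * c)"
          using \<alpha> by (simp add: E_def mult_left_mono)
        then have "E x * (u \<bullet> (x - m)) \<le> exp (- \<alpha> * c) * \<bar>u \<bullet> (x - m)\<bar>"
          using E(1)[of x] by (intro order_trans[OF mult_left_mono[OF abs_ge_self] mult_right_mono]) auto
        then show ?thesis
          unfolding eq using K0 E(1)[of x] by (smt (verit) mult_nonneg_nonneg)
      qed
    qed
  qed
  also have "\<dots> = K * Z + exp (- \<alpha> * c) * (\<integral>x. \<bar>u \<bullet> (x - m)\<bar> \<partial>law p)"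
    using mom[OF u(1)] Eint by (simp add: Z_def)
  also have "\<dots> \<le> K * Z + exp (- \<alpha> * c) * M"
    using momM[OF u(1)] by simp
  finally have "Z * norm (X - m) \<le> K * Z + exp (- \<alpha> * c) * M" .
  then have "norm (X - m) \<le> K + exp (- \<alpha> * c) * M / Z"
    using Z by (simp add: field_simps)
  also have "\<dots> \<le> K + exp (- \<alpha> * c) * M / (exp (- \<alpha> * a) * P)"
  proof -
    \<comment> \<open>Replacing \<open>Z\<close> by its lower bound in the denominator needs a
      nonnegative numerator; \<open>M\<close> dominates the integral of an absolute value.\<close>
    have "0 \<le> (\<integral>x. \<bar>u \<bullet> (x - m)\<bar> \<partial>law p)" by simp
    then have "M \<ge> 0" using momM[OF u(1)] by linarith
    then show ?thesis
      using ZP P Z by (intro add_left_mono divide_left_mono) auto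
  qed
  also have "\<dots> = K + exp (- \<alpha> * (c - a)) / P * M"
    by (simp add: right_diff_distrib exp_diff exp_minus field_simps)
  finally show ?thesis by (simp add: X_def P_def)
qed

section \<open>The consensus bound along the solution\<close>

theorem lemma2p3:
  fixes f :: "'a::euclidean_space \<Rightarrow> real" and xstar :: 'a
    and f_inf R0 \<eta> \<nu> \<alpha> lam \<delta> T t r q :: real
    and \<rho> :: "real \<Rightarrow> 'a \<Rightarrow> real"
  assumes "continuous_on UNIV f"
    and "\<And>y. is_arg_min f (\<lambda>_. True) y \<longleftrightarrow> y = xstar"
    and "f xstar = 0"
    and "f_inf > 0" and "R0 > 0" and "\<eta> > 0" and "\<nu> > 0"
    and "\<And>x. x \<in> ball xstar R0 \<Longrightarrow> (f x - f xstar) powr \<nu> \<ge> \<eta> * norm (x - xstar)"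
    and "\<And>x. x \<notin> ball xstar R0 \<Longrightarrow> f x \<ge> f xstar + f_inf"
    and "\<alpha> > 0" and "lam > 0" and "\<delta> > 0" and "T > 0"
    and "smooth_cbo_solution f \<alpha> lam \<delta> T \<rho>"
    and "t \<in> {0..T}"
    and "0 < r" and "r \<le> R0"
    and "0 < q" and "q < f_inf - (SUP x\<in>ball xstar r. f x)"
  shows "ereal (norm (consensus_point \<alpha> f (law (\<rho> t)) - xstar)) \<le>
    ereal ((q + (SUP x\<in>ball xstar r. f x)) powr \<nu> / \<eta>)
    + ereal (\<delta> / lam powr (1 / 2))
      * (ereal (exp (- \<alpha> * q)) / ereal (measure (law (\<rho> t)) (ball xstar r)))
      * (ereal_sqrt (relative_entropy (\<rho> t) (gaussian_density xstar (\<delta>\<^sup>2 / (2 * lam))))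
         + ereal (1 / sqrt 2))"
proof -
  define F where "F = (SUP x\<in>ball xstar r. f x)"
  define v where "v = \<delta>\<^sup>2 / (2 * lam)"
  define P where "P = measure (law (\<rho> t)) (ball xstar r)"
  define K where "K = (q + F) powr \<nu> / \<eta>"
  define H where "H = relative_entropy (\<rho> t) (gaussian_density xstar v)"
  have v: "v > 0" using assms by (simp add: v_def)
  have p: "prob_density (\<rho> t)"
    and num: "integrable (law (\<rho> t)) (\<lambda>x. exp (- \<alpha> * f x) *\<^sub>R x)"
    using assms(14,15) unfolding smooth_cbo_solution_def by blast+
  have [measurable]: "\<rho> t \<in> borel_measurable borel" and p0: "\<And>x. 0 \<le> \<rho> t x"
    using p by (auto simp: prob_density_def)
  have [measurable]: "f \<in> borel_measurable borel"
    using assms(1) by (rule borel_measurable_continuous_onI)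
  have f0: "0 \<le> f x" for x
    using assms(2)[of xstar] assms(3) by (auto simp: is_arg_min_def not_less)
  \<comment> \<open>Boundedness on the compact closed ball makes the real-valued supremum
    \<open>F\<close> a true upper bound on the open ball.\<close>
  have "bdd_above (f ` cball xstar r)"
    using assms(1) by (intro bounded_imp_bdd_above compact_imp_bounded compact_continuous_image)
      (auto intro: continuous_on_subset)
  then have bdd: "bdd_above (f ` ball xstar r)"
    by (rule bdd_above_mono) (use ball_subset_cball in blast)
  have fF: "f x \<le> F" if "x \<in> ball xstar r" for x
    unfolding F_def using that bdd by (rule cSUP_upper)
  have level: "norm (x - xstar) \<le> K" if "f x \<le> q + F" for x
  proof -
    \<comment> \<open>Outside the large ball \<open>f\<close> is at least \<open>f_inf\<close>,
      which exceeds \<open>q + F\<close>, so the growth condition is available here.\<close>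
    have "x \<in> ball xstar R0"
      using assms(9)[of x] assms(3,19) that by (force simp: F_def)
    then have "\<eta> * norm (x - xstar) \<le> f x powr \<nu>"
      using assms(8)[of x] assms(3) by simp
    also have "\<dots> \<le> (q + F) powr \<nu>"
      using that f0[of x] assms(7) by (intro powr_mono2) auto
    finally show ?thesis
      using assms(6) by (simp add: K_def field_simps)
  qed
  have K0: "K \<ge> 0" using assms(6) by (simp add: K_def)
  have H0: "H \<ge> 0"
    unfolding H_def using p v
    by (intro relative_entropy_nonneg has_bochner_integral_gaussian_density gaussian_density_pos) auto
  have "ereal (norm (consensus_point \<alpha> f (law (\<rho> t)) - xstar)) \<le>
    ereal K + ereal (\<delta> / lam powr (1 / 2)) * (ereal (exp (- \<alpha> * q)) / ereal P)
      * (ereal_sqrt H + ereal (1 / sqrt 2))"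
  \<comment> \<open>In these cases the right side is infinite: a positive real divided by 0 is
    \<open>\<infinity>\<close> in \<open>ereal\<close>, and \<open>ereal_sqrt\<close> keeps
    \<open>\<infinity>\<close>.\<close>
  proof (cases "P = 0 \<or> H = \<infinity>")
    case True
    have d: "\<delta> / lam powr (1 / 2) > 0" using assms by simp
    \<comment> \<open>Positivity, guaranteed by the summand \<open>1 / sqrt 2\<close>, rules out the
      product \<open>\<infinity> * 0\<close>, which would be 0.\<close>
    have s: "ereal_sqrt H + ereal (1 / sqrt 2) > 0"
      using H0 by (cases H) (auto simp: ereal_sqrt_def add_nonneg_pos)
    have "P \<ge> 0" by (simp add: P_def)
    show ?thesis
    proof (cases "P = 0")
      case True
      have "ereal (exp (- \<alpha> * q)) / ereal P = \<infinity>"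
        using True by (simp add: divide_ereal_def zero_ereal_def[symmetric])
      then have "ereal (\<delta> / lam powr (1 / 2)) * (ereal (exp (- \<alpha> * q)) / ereal P) = \<infinity>"
        using assms(11,12) by simp
      moreover have "\<infinity> * (ereal_sqrt H + ereal (1 / sqrt 2)) = \<infinity>"
        using s by (cases "ereal_sqrt H + ereal (1 / sqrt 2)") auto
      ultimately show ?thesis by (simp only: plus_ereal.simps ereal_less_eq)
    next
      case False
      then have "H = \<infinity>" using \<open>P = 0 \<or> H = \<infinity>\<close> by simp
      then have "ereal_sqrt H + ereal (1 / sqrt 2) = \<infinity>" by (simp add: ereal_sqrt_def)
      moreover have "ereal c * (ereal e / ereal P) * \<infinity> = \<infinity>" if "c > 0" "e > 0" for c e
        using that False \<open>P \<ge> 0\<close> by simp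
      ultimately have "ereal (\<delta> / lam powr (1 / 2)) * (ereal (exp (- \<alpha> * q)) / ereal P)
          * (ereal_sqrt H + ereal (1 / sqrt 2)) = \<infinity>"
        using d by (simp only: exp_gt_zero)
      then show ?thesis
        by (simp only: plus_ereal.simps ereal_less_eq)
    qed
  next
    case False
    then obtain h where h: "H = ereal h" "h \<ge> 0" using H0 by (cases H) auto
    define M where "M = sqrt v * (1 + sqrt (2 * h))"
    have P: "P > 0" using False by (simp add: P_def less_le)
    have law_int: "integrable (law (\<rho> t)) (\<lambda>x. \<bar>u \<bullet> (x - xstar)\<bar>)"
      "(\<integral>x. \<bar>u \<bullet> (x - xstar)\<bar> \<partial>law (\<rho> t)) \<le> M" if "norm u = 1" for u
      using first_moment_le_entropy[OF p v that h(1)[unfolded H_def]] p0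
      by (simp_all add: law_def integrable_density integral_density M_def mult.commute)
    \<comment> \<open>With the levels \<open>q + F\<close> and \<open>F\<close> the gap is exactly
      \<open>q\<close>.\<close>
    have "norm (consensus_point \<alpha> f (law (\<rho> t)) - xstar) \<le>
        K + exp (- \<alpha> * (q + F - F)) / P * M"
      unfolding P_def
      using assms(10) P
      by (intro consensus_point_dist[OF p _ f0 _ num level K0 fF _ law_int]) (auto simp: P_def)
    \<comment> \<open>The \<open>sqrt 2\<close> in the denominator of \<open>sqrt v\<close> cancels
      against \<open>sqrt (2 * h)\<close> and turns the summand 1 into
      \<open>1 / sqrt 2\<close>.\<close>
    also have "M = \<delta> / lam powr (1 / 2) * (sqrt h + 1 / sqrt 2)"
    proof -
      have "sqrt v = \<delta> / (sqrt 2 * sqrt lam)"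
        using assms(12) by (simp add: v_def real_sqrt_divide real_sqrt_mult)
      then show ?thesis
        using assms(11) by (simp add: M_def real_sqrt_mult powr_half_sqrt distrib_left add_divide_distrib mult.commute)
    qed
    finally show ?thesis
      using P h by (simp add: ereal_sqrt_def mult_ac)
  qed
  then show ?thesis
    unfolding F_def v_def P_def K_def H_def .
qed

end
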